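(* Let $\mathbf{d}=(d_1,\ldots,d_n)$ be a graphic sequence and let $\delta\le n$ be a positive even integer. Then the sequence $\mathbf{d}\circ\delta=(d_1,\ldots,d_n,\delta)$ is graphic if and only if $\mathbf{d}$ has a realization containing a matching of size $\delta/2$.
   Context: A finite sequence of nonnegative integers is graphic if there is a simple graph with a vertex labelling whose degree sequence is that sequence; such a graph is a realization of the sequence. $\mathbf{d}\circ\delta$ denotes the sequence $\mathbf{d}$ with $\delta$ appended at the end. A matching is a set of pairwise disjoint edges. *)

theory Defs
  imports Main
begin

definition simple_graph :: "'a set \<Rightarrow> 'a set set \<Rightarrow> bool" where
  "simple_graph V E \<longleftrightarrow> finite V \<and> (\<forall>e\<in>E. e \<subseteq> V \<and> card e = 2)"

definition vdegree :: "'a set set \<Rightarrow> 'a \<Rightarrow> nat" where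
  "vdegree E v = card {e \<in> E. v \<in> e}"

(* A sequence (d_1,...,d_n) is a list, so d_i is d ! (i - 1); the bijection is the
   vertex labelling. *)
definition realization :: "nat list \<Rightarrow> 'a set \<Rightarrow> 'a set set \<Rightarrow> bool" where
  "realization d V E \<longleftrightarrow> simple_graph V E \<and>
     (\<exists>l. bij_betw l {..<length d} V \<and> (\<forall>i<length d. vdegree E (l i) = d ! i))"

(* Vertices are drawn from nat only because HOL cannot quantify over types inside a
   definition; realization_imp_graphic shows that this loses no generality. *)
definition graphic :: "nat list \<Rightarrow> bool" where
  "graphic d \<longleftrightarrow> (\<exists>(V :: nat set) E. realization d V E)"

definition matching_in :: "'a set set \<Rightarrow> 'a set set \<Rightarrow> bool" where
  "matching_in E M \<longleftrightarrow> M \<subseteq> E \<and> pairwise disjnt M"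

lemma realization_image:
  assumes r: "realization d V E" and f: "inj_on f V"
  shows "realization d (f ` V) ((`) f ` E)"
proof -
  from r obtain l where g: "simple_graph V E" and l: "bij_betw l {..<length d} V"
    and deg: "\<And>i. i < length d \<Longrightarrow> vdegree E (l i) = d ! i"
    by (auto simp: realization_def)
  have sub: "e \<subseteq> V" "card e = 2" if "e \<in> E" for e
    using g that by (auto simp: simple_graph_def)
  have sg: "simple_graph (f ` V) ((`) f ` E)"
    unfolding simple_graph_def
  proof (intro conjI ballI)
    show "finite (f ` V)" using g by (simp add: simple_graph_def)
  next
    fix e assume "e \<in> (`) f ` E"
    then obtain e' where e': "e' \<in> E" "e = f ` e'" by blast
    show "e \<subseteq> f ` V" using sub(1)[OF e'(1)] e'(2) by blast
    show "card e = 2"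
      using card_image[OF inj_on_subset[OF f sub(1)[OF e'(1)]]] sub(2)[OF e'(1)] e'(2) by simp
  qed
  have vd: "vdegree ((`) f ` E) (f v) = vdegree E v" if v: "v \<in> V" for v
  proof -
    have "{e \<in> (`) f ` E. f v \<in> e} = (`) f ` {e \<in> E. v \<in> e}"
      using inj_on_image_mem_iff[OF f v sub(1)] by blast
    moreover have "inj_on ((`) f) {e \<in> E. v \<in> e}"
      using inj_on_image_eq_iff[OF f] sub(1) by (auto simp: inj_on_def[of "(`) f"])
    ultimately show ?thesis by (simp add: vdegree_def card_image)
  qed
  have "bij_betw (f \<circ> l) {..<length d} (f ` V)"
    using bij_betw_trans[OF l inj_on_imp_bij_betw[OF f]] .
  moreover have "\<forall>i<length d. vdegree ((`) f ` E) ((f \<circ> l) i) = d ! i"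
    using vd deg bij_betwE[OF l] by simp
  ultimately show ?thesis using sg unfolding realization_def by blast
qed

lemma realization_imp_graphic:
  assumes "realization d V E"
  shows "graphic d"
proof -
  have "finite V" using assms by (simp add: realization_def simple_graph_def)
  then obtain f :: "_ \<Rightarrow> nat" where "inj_on f V" using finite_imp_inj_to_nat_seg by blast
  then show ?thesis using realization_image[OF assms] graphic_def by blast
qed

end

theory Submission
  imports Defs
begin

text \<open>
  If a realization of \<open>d\<close> contains a matching with \<open>\<delta>/2\<close> edges, subdivide these edges and identify
  the subdividing vertices. Conversely, deleting the last vertex of a realization of \<open>d \<circ> \<delta>\<close>
  leaves a graph \<open>H\<close> with degrees \<open>d - 1\<^sub>N\<close>, where \<open>N\<close> has size \<open>\<delta>\<close>. Among all pairs of a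
  realization \<open>G\<close> of \<open>d\<close> and such an \<open>H\<close> on the same labelled vertices, minimise the number of
  edges of \<open>H - G\<close> (blue). Then \<open>H \<subseteq> G\<close>, so that \<open>G - H\<close> (red) is a perfect matching of \<open>N\<close>:
  by minimality the ends of every red-blue-red path are joined by a red edge. Let \<open>ab\<close> be blue
  with the red degree of \<open>a\<close> largest among the vertices on blue edges, and \<open>by\<close> red. The red
  neighbours of \<open>y\<close> include \<open>b\<close> and those of \<open>a\<close> other than \<open>y\<close>, and also \<open>a\<close> if \<open>ay\<close> is red.
  So \<open>y\<close> has larger red degree than \<open>a\<close>, hence at least two red edges and thus a blue one,
  against the choice of \<open>a\<close>.
\<close>

section \<open>Degrees and neighbourhoods in simple graphs\<close>

lemma simple_graph_finite: "simple_graph V E \<Longrightarrow> finite E"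
  by (rule finite_subset[of _ "Pow V"]) (auto simp: simple_graph_def)

lemma simple_graph_mono: "simple_graph V E \<Longrightarrow> F \<subseteq> E \<Longrightarrow> simple_graph V F"
  by (auto simp: simple_graph_def)

lemma simple_graph_edgeD:
  assumes "simple_graph V E" "{x, y} \<in> E"
  shows "x \<in> V" "y \<in> V" "x \<noteq> y"
  using assms by (auto simp: simple_graph_def)

lemma simple_graph_edgeE:
  assumes "simple_graph V E" "e \<in> E" "v \<in> e"
  obtains x where "e = {v, x}"
proof -
  have "card e = 2" using assms by (auto simp: simple_graph_def)
  then show ?thesis using assms(3) that by (auto simp: card_2_iff)
qed

lemma vdegree_insert:
  assumes "finite E" "e \<notin> E"
  shows "vdegree (insert e E) v = vdegree E v + of_bool (v \<in> e)"
proof -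
  have "{e' \<in> insert e E. v \<in> e'} = (if v \<in> e then insert e {e' \<in> E. v \<in> e'} else {e' \<in> E. v \<in> e'})"
    by auto
  then show ?thesis using assms by (simp add: vdegree_def)
qed

lemma vdegree_Un_disjoint:
  assumes "finite E" "finite F" "E \<inter> F = {}"
  shows "vdegree (E \<union> F) v = vdegree E v + vdegree F v"
proof -
  have "{e \<in> E \<union> F. v \<in> e} = {e \<in> E. v \<in> e} \<union> {e \<in> F. v \<in> e}" by auto
  then show ?thesis using assms unfolding vdegree_def
    by (simp add: card_Un_disjoint disjoint_iff)
qed

lemma vdegree_Diff:
  assumes "finite E"
  shows "vdegree E v = vdegree (E - F) v + vdegree (E \<inter> F) v"
  using vdegree_Un_disjoint[of "E - F" "E \<inter> F" v] assms by (auto simp: Un_Diff_Int)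

lemma vdegree_eq_card_neighbours:
  assumes "simple_graph V E"
  shows "vdegree E v = card {x. {v, x} \<in> E}"
proof -
  have "{e \<in> E. v \<in> e} = (\<lambda>x. {v, x}) ` {x. {v, x} \<in> E}"
    by (auto elim: simple_graph_edgeE[OF assms])
  moreover have "inj_on (\<lambda>x. {v, x}) {x. {v, x} \<in> E}"
    by (auto simp: inj_on_def doubleton_eq_iff)
  ultimately show ?thesis by (simp add: vdegree_def card_image)
qed

lemma finite_neighbours:
  assumes "simple_graph V E"
  shows "finite {x. {v, x} \<in> E}"
  by (rule finite_subset[of _ V]) (use assms in \<open>auto simp: simple_graph_def\<close>)

lemma vdegree_pos_iff:
  assumes "simple_graph V E"
  shows "0 < vdegree E v \<longleftrightarrow> (\<exists>x. {v, x} \<in> E)"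
  using finite_neighbours[OF assms] by (auto simp: vdegree_eq_card_neighbours[OF assms] card_gt_0_iff)

lemma vdegree_image:
  assumes "inj_on f V" "simple_graph V E" "v \<in> V"
  shows "vdegree ((`) f ` E) (f v) = vdegree E v"
proof -
  have sub: "e \<subseteq> V" if "e \<in> E" for e using assms(2) that by (simp add: simple_graph_def)
  have "{e \<in> (`) f ` E. f v \<in> e} = (`) f ` {e \<in> E. v \<in> e}"
    using inj_on_image_mem_iff[OF assms(1,3) sub] by blast
  moreover have "inj_on ((`) f) {e \<in> E. v \<in> e}"
    using inj_on_image_eq_iff[OF assms(1)] sub by (auto simp: inj_on_def[of "(`) f"])
  ultimately show ?thesis by (simp add: vdegree_def card_image)
qed

text \<open>Handshake lemma, by counting incidences in two ways. It is applied only to matchings,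
  where it ties the number of edges to the number of covered vertices.\<close>

lemma sum_vdegree:
  assumes "simple_graph V E"
  shows "(\<Sum>v\<in>V. vdegree E v) = 2 * card E"
proof -
  have fin: "finite V" "finite E" using assms simple_graph_finite by (auto simp: simple_graph_def)
  have "(\<Sum>v\<in>V. vdegree E v) = (\<Sum>v\<in>V. \<Sum>e\<in>E. of_bool (v \<in> e))"
    using fin by (simp add: vdegree_def Int_def conj_commute)
  also have "\<dots> = (\<Sum>e\<in>E. \<Sum>v\<in>V. of_bool (v \<in> e))" by (rule sum.swap)
  also have "\<dots> = (\<Sum>e\<in>E. card e)"
  proof (rule sum.cong[OF refl])
    fix e assume "e \<in> E"
    then have "V \<inter> e = e" using assms by (auto simp: simple_graph_def)
    then show "(\<Sum>v\<in>V. of_bool (v \<in> e)) = card e" using fin by simp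
  qed
  also have "\<dots> = 2 * card E" using assms by (simp add: simple_graph_def)
  finally show ?thesis .
qed

text \<open>Distinct members fail to be disjoint exactly when some point lies in both. Hence a
  matching can be recognised from degrees alone.\<close>

lemma pairwise_disjnt_iff_vdegree_le_1:
  assumes "finite M"
  shows "pairwise disjnt M \<longleftrightarrow> (\<forall>v. vdegree M v \<le> 1)"
proof -
  have "finite {e \<in> M. v \<in> e}" for v using assms by simp
  note card_le_Suc0_iff_eq[OF this]
  then show ?thesis by (auto simp: vdegree_def pairwise_def disjnt_iff)
qed

text \<open>Renaming every vertex to its index, by the inverse of the labelling, makes the labelling
  the identity. Realizations of \<open>d\<close> and of \<open>d @ [\<delta>]\<close> can then be
  compared edge by edge.\<close>

lemma graphic_iff_lessThan:
  "graphic d \<longleftrightarrow> (\<exists>E. simple_graph {..<length d} E \<and> (\<forall>i<length d. vdegree E i = d ! i))"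
proof
  assume "graphic d"
  then obtain V :: "nat set" and E l where r: "realization d V E" and g: "simple_graph V E"
    and l: "bij_betw l {..<length d} V" and deg: "\<And>i. i < length d \<Longrightarrow> vdegree E (l i) = d ! i"
    by (auto simp: graphic_def realization_def)
  define f where "f = inv_into {..<length d} l"
  have f: "bij_betw f V {..<length d}" unfolding f_def by (rule bij_betw_inv_into[OF l])
  then have inj: "inj_on f V" and img: "f ` V = {..<length d}" by (auto simp: bij_betw_def)
  have "simple_graph {..<length d} ((`) f ` E)"
    using realization_image[OF r inj] img by (simp add: realization_def)
  moreover have "vdegree ((`) f ` E) i = d ! i" if "i < length d" for i
  proof -
    have "f (l i) = i" using that l by (simp add: f_def bij_betw_inv_into_left)
    moreover have "l i \<in> V" using that bij_betwE[OF l] by simp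
    ultimately show ?thesis using vdegree_image[OF inj g, of "l i"] deg[OF that] by simp
  qed
  ultimately show "\<exists>E. simple_graph {..<length d} E \<and> (\<forall>i<length d. vdegree E i = d ! i)" by blast
next
  assume "\<exists>E. simple_graph {..<length d} E \<and> (\<forall>i<length d. vdegree E i = d ! i)"
  then obtain E where "simple_graph {..<length d} E" "\<forall>i<length d. vdegree E (id i) = d ! i" by auto
  then have "realization d {..<length d} E" unfolding realization_def using bij_betw_id by blast
  then show "graphic d" by (auto simp: graphic_def)
qed

section \<open>Degree-preserving switches\<close>

definition switch :: "'a \<Rightarrow> 'a \<Rightarrow> 'a \<Rightarrow> 'a \<Rightarrow> 'a set set \<Rightarrow> 'a set set" where
  "switch a b c d E = insert {b, c} (insert {a, d} (E - {{a, b}, {c, d}}))"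

text \<open>Edges and non-edges alternate along the closed walk a, b, c, d, and each of its vertices
  loses one edge and gains one. The inequalities \<open>ne\<close> keep the new edges from being
  singletons, which a non-membership in \<open>E\<close> cannot do.\<close>

lemma switch:
  assumes g: "simple_graph V E"
    and E: "{a, b} \<in> E" "{c, d} \<in> E" "{b, c} \<notin> E" "{a, d} \<notin> E" and ne: "b \<noteq> c" "a \<noteq> d"
  shows "simple_graph V (switch a b c d E)"
    and "vdegree (switch a b c d E) v = vdegree E v"
proof -
  have in_V: "a \<in> V" "b \<in> V" "c \<in> V" "d \<in> V" and ne': "a \<noteq> b" "c \<noteq> d"
    using simple_graph_edgeD[OF g] E by blast+
  then show "simple_graph V (switch a b c d E)"
    using g ne by (auto simp: simple_graph_def switch_def)
  \<comment> \<open>Otherwise an edge and a non-edge of the walk would coincide.\<close>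
  have ne2: "a \<noteq> c" "b \<noteq> d" using E by (auto simp: insert_commute)
  \<comment> \<open>\<open>F\<close> is the part untouched by the switch; both graphs arise from it
    by inserting two edges.\<close>
  define F where "F = E - {{a, b}, {c, d}}"
  have F: "finite F" unfolding F_def using simple_graph_finite[OF g] by simp
  have "E = insert {a, b} (insert {c, d} F)" using E unfolding F_def by auto
  moreover have "{c, d} \<notin> F" "{a, b} \<notin> insert {c, d} F"
    using ne2 ne by (auto simp: F_def doubleton_eq_iff)
  ultimately have "vdegree E v = vdegree F v + of_bool (v \<in> {c, d}) + of_bool (v \<in> {a, b})"
    using F vdegree_insert[of "insert {c, d} F" "{a, b}" v] vdegree_insert[of F "{c, d}" v] by simp
  moreover have "vdegree (switch a b c d E) v
      = vdegree F v + of_bool (v \<in> {a, d}) + of_bool (v \<in> {b, c})"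
    unfolding switch_def F_def[symmetric]
    using F E ne2 ne' by (subst vdegree_insert; (subst vdegree_insert)?)
      (auto simp: F_def doubleton_eq_iff)
  ultimately show "vdegree (switch a b c d E) v = vdegree E v" using ne ne' ne2 by auto
qed

text \<open>The minimal pair is found by induction on \<open>card (H - G)\<close>: a red-blue-red
  path whose ends are not joined by a red edge permits a switch in one of the two graphs that lowers
  this number, and the absence of such paths forces \<open>H - G\<close> to be empty.\<close>

lemma realization_nested:
  assumes "simple_graph V G" "simple_graph V H"
    and "\<And>v. vdegree H v \<le> vdegree G v" "\<And>v. vdegree G v \<le> vdegree H v + 1"
  shows "\<exists>G' H'. simple_graph V G' \<and> H' \<subseteq> G' \<and>
    (\<forall>v. vdegree G' v = vdegree G v) \<and> (\<forall>v. vdegree H' v = vdegree H v)"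
  using assms
proof (induction "card (H - G)" arbitrary: G H rule: less_induct)
  case less
  note G = less.prems(1) and H = less.prems(2) and deg = less.prems(3,4)
  note fin = simple_graph_finite[OF G] simple_graph_finite[OF H]
  have finV: "finite V" using G by (simp add: simple_graph_def)
  define R where "R = G - H"
  define B where "B = H - G"
  have R: "simple_graph V R" and B: "simple_graph V B"
    using G H by (auto simp: R_def B_def intro: simple_graph_mono)
  \<comment> \<open>Edges common to \<open>G\<close> and \<open>H\<close> contribute equally to both
    degrees and cancel.\<close>
  have degR: "vdegree B v \<le> vdegree R v" "vdegree R v \<le> vdegree B v + 1" for v
    using deg[of v] vdegree_Diff[OF fin(1), of v H] vdegree_Diff[OF fin(2), of v G]
    by (simp_all add: R_def B_def Int_commute)
  show ?case
  proof (cases "B = {}")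
    case True
    then show ?thesis using G unfolding B_def by blast
  next
    case False
    show ?thesis
    proof (cases "\<exists>x a b y. {x, a} \<in> R \<and> {a, b} \<in> B \<and> {b, y} \<in> R \<and> x \<noteq> y \<and> {x, y} \<notin> R")
      case True
      then obtain x a b y where e: "{x, a} \<in> R" "{a, b} \<in> B" "{b, y} \<in> R" "x \<noteq> y" "{x, y} \<notin> R"
        by blast
      have "a \<noteq> b" using simple_graph_edgeD[OF B e(2)] by simp
      show ?thesis
      proof (cases "{x, y} \<in> G")
        case False
        \<comment> \<open>The edges \<open>{x, a}\<close> and \<open>{b, y}\<close> removed from
          \<open>G\<close> are not in \<open>H\<close>, so \<open>H - G\<close> gains nothing and
          loses \<open>{a, b}\<close>.\<close>
        define G' where "G' = switch x a b y G"
        have G': "simple_graph V G'" "\<And>v. vdegree G' v = vdegree G v"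
          unfolding G'_def using switch[OF G, of x a b y] e False \<open>a \<noteq> b\<close> by (auto simp: R_def B_def)
        have "H - G' \<subset> H - G" using e by (auto simp: G'_def switch_def R_def B_def)
        then have "card (H - G') < card (H - G)" by (intro psubset_card_mono) (use fin in auto)
        from less.hyps[OF this G'(1) H] G'(2) deg show ?thesis by simp
      next
        case True
        then have "{x, y} \<in> H" using e by (simp add: R_def)
        \<comment> \<open>Now the switch is made in \<open>H\<close>: the edges
          \<open>{a, x}\<close> and \<open>{b, y}\<close> that it gains lie in \<open>G\<close>, so
          \<open>H - G\<close> again only loses edges, among them \<open>{a, b}\<close>.\<close>
        define H' where "H' = switch b a x y H"
        have H': "simple_graph V H'" "\<And>v. vdegree H' v = vdegree H v"
          unfolding H'_def using switch[OF H, of b a x y] e \<open>{x, y} \<in> H\<close> \<open>a \<noteq> b\<close>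
            simple_graph_edgeD[OF R]
          by (auto simp: R_def B_def insert_commute)
        have "{a, b} \<in> H - G" "{a, b} \<notin> H'" "H' - G \<subseteq> H - G"
          using e by (auto simp: H'_def switch_def R_def B_def doubleton_eq_iff insert_commute)
        then have "H' - G \<subset> H - G" by blast
        then have "card (H' - G) < card (H - G)" by (intro psubset_card_mono) (use fin in auto)
        from less.hyps[OF this G H'(1)] H'(2) deg show ?thesis by simp
      qed
    next
      case False
      then have red: "{x, y} \<in> R" if "{x, a} \<in> R" "{a, b} \<in> B" "{b, y} \<in> R" "x \<noteq> y" for x a b y
        using that by blast
      define S where "S = {v. \<exists>x. {v, x} \<in> B}"
      have "S \<subseteq> V" using simple_graph_edgeD[OF B] by (auto simp: S_def)
      then have "finite S" using finV finite_subset by blast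
      from \<open>B \<noteq> {}\<close> obtain e where "e \<in> B" by blast
      then obtain u v where "{u, v} \<in> B" using B by (auto simp: simple_graph_def card_2_iff)
      then have "S \<noteq> {}" by (auto simp: S_def)
      then obtain a where a: "a \<in> S" "\<And>v. v \<in> S \<Longrightarrow> vdegree R v \<le> vdegree R a"
        using Max_in[of "vdegree R ` S"] Max_ge[of "vdegree R ` S"] \<open>finite S\<close> by fastforce
      obtain b where b: "{a, b} \<in> B" using a(1) by (auto simp: S_def)
      have posB: "v \<in> S \<longleftrightarrow> 0 < vdegree B v" for v by (simp add: S_def vdegree_pos_iff[OF B])
      have "b \<in> S" using b by (auto simp: S_def insert_commute)
      then obtain y where y: "{b, y} \<in> R"
        using posB degR(1)[of b] vdegree_pos_iff[OF R, of b] by fastforce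
      define Na where "Na = {x. {a, x} \<in> R}"
      define Ny where "Ny = {x. {y, x} \<in> R}"
      have fin_N: "finite Na" "finite Ny" using finite_neighbours[OF R] by (simp_all add: Na_def Ny_def)
      have ab: "a \<noteq> b" "b \<notin> Na" "a \<notin> Na"
        using b simple_graph_edgeD[OF B b] simple_graph_edgeD(3)[OF R, of a a]
        by (auto simp: Na_def R_def B_def)
      \<comment> \<open>Every red neighbour x of \<open>a\<close> other than \<open>y\<close> starts
        a red-blue-red path x, \<open>a\<close>, \<open>b\<close>, \<open>y\<close>.\<close>
      have sub: "insert b (Na - {y}) \<subseteq> Ny"
        using red[of _ a b y] b y by (auto simp: Na_def Ny_def insert_commute)
      \<comment> \<open>If \<open>y\<close> is itself a red neighbour of \<open>a\<close>, then
        \<open>a\<close> is one of \<open>y\<close> and makes up for the removed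
        \<open>y\<close>.\<close>
      have "card Na + 1 \<le> card Ny"
      proof (cases "y \<in> Na")
        case True
        then have "insert a (insert b (Na - {y})) \<subseteq> Ny"
          using sub by (auto simp: Na_def Ny_def insert_commute)
        from card_mono[OF fin_N(2) this] show ?thesis
          using True fin_N ab card_Suc_Diff1[OF fin_N(1) True] by simp
      next
        case False
        then show ?thesis using card_mono[OF fin_N(2) sub] fin_N ab by simp
      qed
      then have "vdegree R a < vdegree R y"
        by (simp add: vdegree_eq_card_neighbours[OF R] Na_def Ny_def)
      moreover have "0 < vdegree R a" using a(1) posB degR(1)[of a] by simp
      ultimately have "y \<in> S" using posB degR(2)[of y] by simp
      then show ?thesis using a(2)[of y] \<open>vdegree R a < vdegree R y\<close> by simp
    qed
  qed
qed

section \<open>Deleting the last vertex\<close>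

lemma graphic_append_imp_matching:
  assumes "graphic d" "graphic (d @ [\<delta>])"
  shows "\<exists>(V :: nat set) E M. realization d V E \<and> matching_in E M \<and> card M = \<delta> div 2"
proof -
  define n where "n = length d"
  obtain G where G: "simple_graph {..<n} G" "\<And>i. i < n \<Longrightarrow> vdegree G i = d ! i"
    using assms(1) unfolding graphic_iff_lessThan n_def by blast
  obtain E where E: "simple_graph {..<Suc n} E" "\<And>i. i < Suc n \<Longrightarrow> vdegree E i = (d @ [\<delta>]) ! i"
    using assms(2) unfolding graphic_iff_lessThan n_def by auto
  define N where "N = {x. {n, x} \<in> E}"
  define H where "H = {e \<in> E. n \<notin> e}"
  have H: "simple_graph {..<n} H"
    using E(1) by (auto simp: simple_graph_def H_def less_Suc_eq subset_iff)
  have N: "N \<subseteq> {..<n}" using simple_graph_edgeD[OF E(1)] by (fastforce simp: N_def less_Suc_eq)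
  \<comment> \<open>\<open>realization_nested\<close> compares degrees at all elements of the type,
    including those that are not vertices.\<close>
  have out: "vdegree F v = 0" if "simple_graph {..<n} F" "\<not> v < n" for F v
    using that by (auto simp: simple_graph_def vdegree_def card_eq_0_iff)
  have degH: "vdegree G v = vdegree H v + of_bool (v \<in> N)" for v
  proof (cases "v < n")
    case True
    have e_eq: "e = {n, v}" if e: "e \<in> E" "n \<in> e" "v \<in> e" for e
    proof -
      obtain x where "e = {n, x}" by (rule simple_graph_edgeE[OF E(1) e(1,2)])
      then show ?thesis using e(3) True by simp
    qed
    have "{e \<in> E - H. v \<in> e} = {{n, v}} \<inter> E" using e_eq by (auto simp: H_def)
    also have "\<dots> = (if v \<in> N then {{n, v}} else {})" by (simp add: N_def)
    finally have "{e \<in> E - H. v \<in> e} = (if v \<in> N then {{n, v}} else {})" .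
    then have "vdegree (E - H) v = of_bool (v \<in> N)" by (simp add: vdegree_def)
    moreover have "E \<inter> H = H" by (auto simp: H_def)
    moreover have "vdegree E v = d ! v" using E(2)[of v] True by (simp add: nth_append n_def)
    ultimately show ?thesis
      using vdegree_Diff[OF simple_graph_finite[OF E(1)], of v H] G(2)[OF True] by simp
  next
    case False
    then show ?thesis using out G H N by auto
  qed
  have "vdegree H v \<le> vdegree G v" "vdegree G v \<le> vdegree H v + 1" for v
    using degH[of v] by simp_all
  then obtain G' H' where G': "simple_graph {..<n} G'" "H' \<subseteq> G'"
    and deg': "\<And>v. vdegree G' v = vdegree G v" "\<And>v. vdegree H' v = vdegree H v"
    using realization_nested[OF G(1) H] by blast
  define M where "M = G' - H'"
  have M: "simple_graph {..<n} M" using G'(1) unfolding M_def by (rule simple_graph_mono) auto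
  have "G' \<inter> H' = H'" using G'(2) by auto
  \<comment> \<open>Degrees subtract because \<open>H'\<close> lies inside \<open>G'\<close>, and
    the switches have left them as in \<open>G\<close> and \<open>H\<close>.\<close>
  then have degM: "vdegree M v = of_bool (v \<in> N)" for v
    using vdegree_Diff[OF simple_graph_finite[OF G'(1)], of v H'] degH[of v] deg'[of v]
    by (simp add: M_def)
  have "2 * card M = card N"
    using sum_vdegree[OF M] N by (simp add: degM Int_absorb1)
  also have "card N = \<delta>"
    using vdegree_eq_card_neighbours[OF E(1), of n] E(2)[of n] by (simp add: N_def n_def)
  finally have "card M = \<delta> div 2" by simp
  moreover have "matching_in G' M"
    using pairwise_disjnt_iff_vdegree_le_1[OF simple_graph_finite[OF M]] degM
    by (auto simp: matching_in_def M_def)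
  moreover have "realization d {..<n} G'"
    unfolding realization_def using G' deg' G(2) bij_betw_id[of "{..<n}"]
    by (auto simp: n_def intro!: exI[of _ id])
  ultimately show ?thesis by blast
qed

section \<open>Rerouting a matching through a new vertex\<close>

lemma matching_imp_graphic_append:
  assumes r: "realization d (V :: nat set) E" and m: "matching_in E M"
  shows "graphic (d @ [2 * card M])"
proof -
  from r obtain l where g: "simple_graph V E" and l: "bij_betw l {..<length d} V"
    and deg: "\<And>i. i < length d \<Longrightarrow> vdegree E (l i) = d ! i"
    by (auto simp: realization_def)
  have finV: "finite V" using g by (simp add: simple_graph_def)
  then obtain w where w: "w \<notin> V" using ex_new_if_finite infinite_UNIV_nat by blast
  have ME: "M \<subseteq> E" "pairwise disjnt M" using m by (auto simp: matching_in_def)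
  have M: "simple_graph V M" by (rule simple_graph_mono[OF g ME(1)])
  define N where "N = \<Union>M"
  have N: "N \<subseteq> V" using M by (auto simp: N_def simple_graph_def)
  have degM: "vdegree M v = of_bool (v \<in> N)" for v
  proof -
    have "vdegree M v \<le> 1"
      using ME(2) pairwise_disjnt_iff_vdegree_le_1[OF simple_graph_finite[OF M]] by blast
    moreover have "0 < vdegree M v \<longleftrightarrow> v \<in> N"
      using simple_graph_finite[OF M] by (auto simp: vdegree_def card_gt_0_iff N_def)
    ultimately show ?thesis by auto
  qed
  have cN: "card N = 2 * card M" using sum_vdegree[OF M] N finV by (simp add: degM Int_absorb1)
  \<comment> \<open>The star at the new vertex \<open>w\<close> consists of the halves of all
    subdivided matching edges.\<close>
  define S where "S = (\<lambda>x. {w, x}) ` N"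
  have sub: "w \<notin> e" if "e \<in> E" for e using g w that by (auto simp: simple_graph_def)
  have S: "simple_graph (insert w V) S"
    using N w finV by (auto simp: S_def simple_graph_def card_insert_if)
  have "simple_graph (insert w V) E" using g by (auto simp: simple_graph_def)
  then have g': "simple_graph (insert w V) (E - M \<union> S)"
    using S by (auto simp: simple_graph_def)
  have disj: "(E - M) \<inter> S = {}" using sub by (auto simp: S_def)
  have split: "vdegree (E - M \<union> S) v = vdegree (E - M) v + vdegree S v" for v
    using vdegree_Un_disjoint[OF _ simple_graph_finite[OF S] disj] simple_graph_finite[OF g] by simp
  have "vdegree (E - M) w = 0" using sub by (auto simp: vdegree_def card_eq_0_iff)
  moreover have "vdegree S w = card N"
  proof -
    have "{x. {w, x} \<in> S} = N" using N w by (auto simp: S_def doubleton_eq_iff)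
    then show ?thesis using vdegree_eq_card_neighbours[OF S] by simp
  qed
  ultimately have degw: "vdegree (E - M \<union> S) w = 2 * card M" using split cN by simp
  \<comment> \<open>A vertex covered by \<open>M\<close> trades its matching edge for the edge to
    \<open>w\<close>.\<close>
  have degv: "vdegree (E - M \<union> S) v = vdegree E v" if "v \<in> V" for v
  proof -
    have "{e \<in> S. v \<in> e} = (if v \<in> N then {{w, v}} else {})" using that w by (auto simp: S_def)
    then have "vdegree S v = of_bool (v \<in> N)" by (simp add: vdegree_def)
    then show ?thesis
      using split vdegree_Diff[OF simple_graph_finite[OF g], of v M] degM[of v] ME(1)
      by (simp add: Int_absorb1)
  qed
  \<comment> \<open>Indices start at 0, so the appended entry has index \<open>length d\<close>, and
    \<open>w\<close> takes this label.\<close>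
  define l' where "l' = l(length d := w)"
  have l'_l: "l' i = l i" if "i < length d" for i using that by (simp add: l'_def)
  have "bij_betw l' {..<length d} V" using l l'_l by (subst bij_betw_cong[of _ l' l]) auto
  then have "bij_betw l' ({..<length d} \<union> {length d}) (V \<union> {l' (length d)})"
    using w by (subst notIn_Un_bij_betw3[symmetric]) (auto simp: l'_def)
  moreover have "{..<length d} \<union> {length d} = {..<length (d @ [2 * card M])}" by auto
  ultimately have "bij_betw l' {..<length (d @ [2 * card M])} (insert w V)"
    by (simp add: l'_def)
  moreover have "vdegree (E - M \<union> S) (l' i) = (d @ [2 * card M]) ! i"
    if "i < length (d @ [2 * card M])" for i
  proof (cases "i < length d")
    case True
    then show ?thesis using l'_l degv deg bij_betwE[OF l] by (simp add: nth_append)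
  next
    case False
    then have "i = length d" using that by simp
    then show ?thesis using degw by (simp add: l'_def)
  qed
  ultimately have "realization (d @ [2 * card M]) (insert w V) (E - M \<union> S)"
    using g' unfolding realization_def by blast
  then show ?thesis by (auto simp: graphic_def)
qed

theorem theorem2p5:
  fixes d :: "nat list" and \<delta> :: nat
  assumes "graphic d"
    and "0 < \<delta>"
    and "even \<delta>"
    and "\<delta> \<le> length d"
  shows "graphic (d @ [\<delta>]) \<longleftrightarrow>
    (\<exists>(V :: nat set) E M. realization d V E \<and> matching_in E M \<and> card M = \<delta> div 2)"
proof
  assume "graphic (d @ [\<delta>])"
  then show "\<exists>(V :: nat set) E M. realization d V E \<and> matching_in E M \<and> card M = \<delta> div 2"
    by (rule graphic_append_imp_matching[OF assms(1)])
next
  assume "\<exists>(V :: nat set) E M. realization d V E \<and> matching_in E M \<and> card M = \<delta> div 2"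
  then show "graphic (d @ [\<delta>])"
    \<comment> \<open>Evenness turns twice \<open>\<delta> div 2\<close> back into
      \<open>\<delta>\<close>.\<close>
    using matching_imp_graphic_append assms(3) by fastforce
qed

end
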